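(* Let $p$ and $q$ be primes with $q\equiv 1 \pmod p$, let $r$ be an integer with $r^p\equiv 1\pmod q$ and $r\not\equiv 1\pmod q$, and let $F_{p,q}=\langle a,b\mid a^p=b^q=1,\ a^{-1}ba=b^r\rangle$, the non-abelian group of order $pq$. Then $\mathcal{E}_c^-(F_{p,q})\cong K_{q\cdot(p-1)}$.
   Context: For elements $x,y$ of a group, $[x,y]=x^{-1}y^{-1}xy$, $[x,{}_1y]=[x,y]$ and $[x,{}_{k+1}y]=[[x,{}_ky],y]$ for $k\ge 1$. For a finite group $G$ with Fitting subgroup $F(G)$, $\mathcal{E}_c^-(G)$ is the simple undirected graph with vertex set $G\setminus F(G)$ in which distinct $x,y$ are adjacent iff $[x,{}_ky]\neq 1$ and $[y,{}_kx]\neq 1$ for all positive integers $k$. $K_{a\cdot b}$ is the complete $a$-partite graph in which each of the $a$ parts has size $b$. *)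

theory Defs
  imports
    "HOL-Number_Theory.Cong"
    "HOL-Computational_Algebra.Primes"
    "HOL-Algebra.Coset"
    "HOL-Algebra.Generated_Groups"
    "Graph_Theory.Pair_Digraph"
    "Graph_Theory.Digraph_Isomorphism"
begin

section \<open>Groups given by generators and relations\<close>

text \<open>
  A letter \<open>(g, True)\<close> stands for the generator \<open>g\<close> and \<open>(g, False)\<close> for its formal inverse.
  A relation \<open>u = v\<close> is a pair of words.
\<close>

type_synonym 'g word = "('g \<times> bool) list"

definition gen_pow :: "'g \<Rightarrow> int \<Rightarrow> 'g word" where
  "gen_pow g k = replicate (nat \<bar>k\<bar>) (g, 0 \<le> k)"

text \<open>The least congruence on words that contains the relations and all free cancellations.\<close>

inductive pres_eq :: "('g word \<times> 'g word) set \<Rightarrow> 'g word \<Rightarrow> 'g word \<Rightarrow> bool"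
  for R :: "('g word \<times> 'g word) set" where
  relation: "(u, v) \<in> R \<Longrightarrow> pres_eq R u v"
| cancel: "pres_eq R [(g, e), (g, \<not> e)] []"
| refl: "pres_eq R u u"
| sym: "pres_eq R u v \<Longrightarrow> pres_eq R v u"
| trans: "pres_eq R u v \<Longrightarrow> pres_eq R v w \<Longrightarrow> pres_eq R u w"
| append: "pres_eq R u u' \<Longrightarrow> pres_eq R v v' \<Longrightarrow> pres_eq R (u @ v) (u' @ v')"

definition word_class :: "('g word \<times> 'g word) set \<Rightarrow> 'g word \<Rightarrow> 'g word set" where
  "word_class R u = {v. pres_eq R u v}"

text \<open>The generating set is the whole type \<open>'g\<close>.\<close>

definition presented_group :: "('g word \<times> 'g word) set \<Rightarrow> 'g word set monoid" where
  "presented_group R =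
    \<lparr>carrier = range (word_class R),
     mult = (\<lambda>X Y. \<Union>u\<in>X. \<Union>v\<in>Y. word_class R (u @ v)),
     one = word_class R []\<rparr>"

lemma word_class_eq_iff: "word_class R u = word_class R v \<longleftrightarrow> pres_eq R u v"
proof
  assume "word_class R u = word_class R v"
  moreover have "v \<in> word_class R v"
    by (simp add: word_class_def pres_eq.refl)
  ultimately show "pres_eq R u v"
    by (simp add: word_class_def set_eq_iff)
next
  assume "pres_eq R u v"
  then have "pres_eq R u w \<longleftrightarrow> pres_eq R v w" for w
    by (meson pres_eq.sym pres_eq.trans)
  then show "word_class R u = word_class R v"
    by (simp add: word_class_def)
qed

lemma mult_word_class:
  "word_class R u \<otimes>\<^bsub>presented_group R\<^esub> word_class R v = word_class R (u @ v)"
proof -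
  have "word_class R (u' @ v') \<subseteq> word_class R (u @ v)"
    if "u' \<in> word_class R u" "v' \<in> word_class R v" for u' v'
  proof -
    have "pres_eq R (u @ v) (u' @ v')"
      using that pres_eq.append unfolding word_class_def by blast
    then show ?thesis
      using word_class_eq_iff by blast
  qed
  then have "(\<Union>u'\<in>word_class R u. \<Union>v'\<in>word_class R v. word_class R (u' @ v'))
      \<subseteq> word_class R (u @ v)"
    by blast
  moreover have "u \<in> word_class R u" "v \<in> word_class R v"
    by (simp_all add: word_class_def pres_eq.refl)
  then have "word_class R (u @ v)
      \<subseteq> (\<Union>u'\<in>word_class R u. \<Union>v'\<in>word_class R v. word_class R (u' @ v'))"
    by blast
  ultimately show ?thesis
    by (simp add: presented_group_def)
qed

lemma one_presented_group: "\<one>\<^bsub>presented_group R\<^esub> = word_class R []"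
  by (simp add: presented_group_def)

lemma carrier_presented_group: "carrier (presented_group R) = range (word_class R)"
  by (simp add: presented_group_def)

lemma pres_eq_left_inverse:
  "pres_eq R (rev (map (\<lambda>(g, e). (g, \<not> e)) u) @ u) []"
proof (induction u)
  case Nil
  show ?case by (simp add: pres_eq.refl)
next
  case (Cons l u)
  obtain g e where l: "l = (g, e)" by (cases l)
  let ?i = "rev (map (\<lambda>(g, e). (g, \<not> e)) u)"
  have "pres_eq R ([(g, \<not> e), (g, e)] @ u) ([] @ u)"
    using pres_eq.cancel[of R g "\<not> e"] by (intro pres_eq.append) (auto intro: pres_eq.refl)
  then have "pres_eq R (?i @ ([(g, \<not> e), (g, e)] @ u)) (?i @ u)"
    by (intro pres_eq.append) (auto intro: pres_eq.refl)
  then have "pres_eq R (?i @ ([(g, \<not> e), (g, e)] @ u)) []"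
    using Cons.IH pres_eq.trans by blast
  then show ?case by (simp add: l)
qed

lemma group_presented_group: "group (presented_group R)"
proof (rule groupI)
  fix x assume "x \<in> carrier (presented_group R)"
  then obtain u where "x = word_class R u" by (auto simp: carrier_presented_group)
  then show "\<exists>y\<in>carrier (presented_group R). y \<otimes>\<^bsub>presented_group R\<^esub> x = \<one>\<^bsub>presented_group R\<^esub>"
    using pres_eq_left_inverse[of R u]
    by (auto simp: carrier_presented_group mult_word_class one_presented_group word_class_eq_iff)
qed (auto simp: carrier_presented_group mult_word_class one_presented_group)

text \<open>
  \<open>F\<^bsub>p,q\<^esub> = \<langle>a, b | a\<^sup>p = b\<^sup>q = 1, a\<^sup>-\<^sup>1 b a = b\<^sup>r\<rangle>\<close>.
\<close>

datatype gen = Gen_a | Gen_b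

definition F_relations :: "nat \<Rightarrow> nat \<Rightarrow> int \<Rightarrow> (gen word \<times> gen word) set" where
  "F_relations p q r =
    {(gen_pow Gen_a (int p), []),
     (gen_pow Gen_b (int q), []),
     (gen_pow Gen_a (-1) @ gen_pow Gen_b 1 @ gen_pow Gen_a 1, gen_pow Gen_b r)}"

definition F_group :: "nat \<Rightarrow> nat \<Rightarrow> int \<Rightarrow> gen word set monoid" where
  "F_group p q r = presented_group (F_relations p q r)"


section \<open>Commutators, nilpotency and the Fitting subgroup\<close>

text \<open>The library's \<^const>\<open>derived_set\<close> uses the other convention, \<open>x y x\<^sup>-\<^sup>1 y\<^sup>-\<^sup>1\<close>.\<close>

definition commutator :: "('a, 'b) monoid_scheme \<Rightarrow> 'a \<Rightarrow> 'a \<Rightarrow> 'a" where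
  "commutator G x y = inv\<^bsub>G\<^esub> x \<otimes>\<^bsub>G\<^esub> inv\<^bsub>G\<^esub> y \<otimes>\<^bsub>G\<^esub> x \<otimes>\<^bsub>G\<^esub> y"

text \<open>\<open>engel G x k y\<close> is \<open>[x, \<^sub>k y]\<close>, extended by \<open>[x, \<^sub>0 y] = x\<close>.\<close>

primrec engel :: "('a, 'b) monoid_scheme \<Rightarrow> 'a \<Rightarrow> nat \<Rightarrow> 'a \<Rightarrow> 'a" where
  "engel G x 0 y = x"
| "engel G x (Suc k) y = commutator G (engel G x k y) y"

primrec lower_central :: "('a, 'b) monoid_scheme \<Rightarrow> nat \<Rightarrow> 'a set" where
  "lower_central G 0 = carrier G"
| "lower_central G (Suc n) =
    generate G {commutator G x y |x y. x \<in> lower_central G n \<and> y \<in> carrier G}"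

definition nilpotent_group :: "('a, 'b) monoid_scheme \<Rightarrow> bool" where
  "nilpotent_group G \<longleftrightarrow> group G \<and> (\<exists>n. lower_central G n = {\<one>\<^bsub>G\<^esub>})"

definition fitting :: "('a, 'b) monoid_scheme \<Rightarrow> 'a set" where
  "fitting G = generate G (\<Union>{N. N \<lhd> G \<and> nilpotent_group (G\<lparr>carrier := N\<rparr>)})"


section \<open>The graphs\<close>

text \<open>
  A simple undirected graph is a symmetric loopfree \<^typ>\<open>'a pair_pre_digraph\<close>
  (\<^locale>\<open>pair_graph\<close> when finite): each edge is represented by its two opposite arcs.
\<close>

definition Ec_minus :: "('a, 'b) monoid_scheme \<Rightarrow> 'a pair_pre_digraph" where
  "Ec_minus G =
    \<lparr>pverts = carrier G - fitting G,
     parcs = {(x, y). x \<in> carrier G - fitting G \<and> y \<in> carrier G - fitting G \<and> x \<noteq> y \<and>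
       (\<forall>k>0. engel G x k y \<noteq> \<one>\<^bsub>G\<^esub> \<and> engel G y k x \<noteq> \<one>\<^bsub>G\<^esub>)}\<rparr>"

text \<open>\<open>K\<^bsub>a\<cdot>b\<^esub>\<close>: the vertex \<open>(i, j)\<close> is the \<open>j\<close>-th vertex of the \<open>i\<close>-th part.\<close>

definition complete_multipartite :: "nat \<Rightarrow> nat \<Rightarrow> (nat \<times> nat) pair_pre_digraph" where
  "complete_multipartite a b =
    \<lparr>pverts = {..<a} \<times> {..<b},
     parcs = {(u, v). u \<in> {..<a} \<times> {..<b} \<and> v \<in> {..<a} \<times> {..<b} \<and> fst u \<noteq> fst v}\<rparr>"

lemma pair_graph_Ec_minus:
  assumes "finite (carrier G)"
  shows "pair_graph (Ec_minus G)"
proof -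
  have "parcs (Ec_minus G) \<subseteq> carrier G \<times> carrier G"
    by (auto simp: Ec_minus_def)
  then have "finite (parcs (Ec_minus G))"
    using assms finite_subset by blast
  with assms show ?thesis
    by unfold_locales (auto simp: Ec_minus_def symmetric_def intro!: symI)
qed

lemma pair_graph_complete_multipartite: "pair_graph (complete_multipartite a b)"
proof -
  have "parcs (complete_multipartite a b) \<subseteq> ({..<a} \<times> {..<b}) \<times> ({..<a} \<times> {..<b})"
    by (auto simp: complete_multipartite_def)
  then have "finite (parcs (complete_multipartite a b))"
    by (rule finite_subset) simp
  then show ?thesis
    by unfold_locales (auto simp: complete_multipartite_def symmetric_def intro!: symI)
qed

end

theory Submission
  imports Defs
begin

text \<open>
  Every element has a unique normal form \<open>a\<^sup>i b\<^sup>j\<close>, and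
  \<open>[a\<^sup>i b\<^sup>j, \<^sub>n a\<^sup>k b\<^sup>l] = b\<^sup>m\<close> with
  \<open>m = (j (r\<^sup>k - 1) - l (r\<^sup>i - 1)) (r\<^sup>k - 1)\<^sup>n\<^sup>-\<^sup>1\<close>. Since \<open>r\<close> has order \<open>p\<close>
  mod \<open>q\<close>, the Fitting subgroup is \<open>\<langle>b\<rangle>\<close>; outside it, one Engel word is trivial iff all are,
  iff the two elements have the same slope \<open>j / (r\<^sup>i - 1)\<close> mod \<open>q\<close>. The slope indexes the parts.
\<close>

section \<open>Engel words in nilpotent normal subgroups\<close>

context group
begin

lemma mult_inv_cancel_left [simp]:
  "x \<in> carrier G \<Longrightarrow> y \<in> carrier G \<Longrightarrow> x \<otimes> (inv x \<otimes> y) = y"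
  by (simp flip: m_assoc)

lemma commutator_eqI:
  assumes "x \<in> carrier G" "y \<in> carrier G" "c \<in> carrier G"
    and "x \<otimes> y = y \<otimes> x \<otimes> c"
  shows "commutator G x y = c"
proof -
  have "commutator G x y = inv (y \<otimes> x) \<otimes> (x \<otimes> y)"
    using assms(1,2) by (simp add: commutator_def inv_mult_group m_assoc)
  also have "\<dots> = c"
    using assms by (simp add: m_assoc inv_solve_left')
  finally show ?thesis .
qed

text \<open>Reduces normality of a subgroup to closure under commutators with arbitrary group
  elements.\<close>

lemma conj_eq_mult_commutator:
  assumes "x \<in> carrier G" "y \<in> carrier G"
  shows "x \<otimes> y \<otimes> inv x = y \<otimes> commutator G y (inv x)"
  using assms by (simp add: commutator_def m_assoc)

lemma commutator_in_normal:
  assumes "N \<lhd> G" "x \<in> N" "y \<in> carrier G"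
  shows "commutator G y x \<in> N"
proof -
  interpret N: normal N G by fact
  have "commutator G y x = (inv y \<otimes> inv x \<otimes> y) \<otimes> x"
    by (simp add: commutator_def)
  then show ?thesis
    using assms N.inv_op_closed1 by simp
qed

lemma commutator_subgroup:
  assumes "subgroup H G" "x \<in> H" "y \<in> H"
  shows "commutator (G\<lparr>carrier := H\<rparr>) x y = commutator G x y"
  using assms by (simp add: commutator_def m_inv_consistent)

text \<open>The first commutator with \<open>x\<close> already falls into \<open>N\<close>, even
  though \<open>y\<close> need not. Each later one descends one step in the lower central series of
  \<open>N\<close>, hence the index shift.\<close>

lemma engel_in_lower_central:
  assumes "N \<lhd> G" "x \<in> N" "y \<in> carrier G"
  shows "engel G y (Suc k) x \<in> lower_central (G\<lparr>carrier := N\<rparr>) k"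
proof (induction k)
  case 0
  then show ?case
    using assms commutator_in_normal by simp
next
  case (Suc k)
  interpret N: normal N G by fact
  \<comment> \<open>Inverses in the subgroup structure agree with those of \<open>G\<close> only on
    \<open>N\<close>, so membership comes before the two commutators can be identified.\<close>
  have N: "engel G y (Suc k) x \<in> N" for k
  proof (induction k)
    case (Suc k)
    then show ?case
      using assms commutator_in_normal N.subset by auto
  qed (use assms commutator_in_normal in simp)
  have "commutator (G\<lparr>carrier := N\<rparr>) (engel G y (Suc k) x) x = engel G y (Suc (Suc k)) x"
    using commutator_subgroup[OF N.subgroup_axioms N assms(2)] by simp
  then show ?case
    using Suc.IH assms(2) by (force intro!: generate.incl)
qed

text \<open>Elements of a nilpotent normal subgroup are left Engel; this bounds the Fitting subgroup
  from above.\<close>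

lemma nilpotent_normal_engel:
  assumes "N \<lhd> G" "nilpotent_group (G\<lparr>carrier := N\<rparr>)" "x \<in> N" "y \<in> carrier G"
  shows "\<exists>k>0. engel G y k x = \<one>"
proof -
  obtain k where "lower_central (G\<lparr>carrier := N\<rparr>) k = {\<one>}"
    using assms(2) by (auto simp: nilpotent_group_def)
  then have "engel G y (Suc k) x = \<one>"
    using engel_in_lower_central[OF assms(1,3,4), of k] by simp
  then show ?thesis by blast
qed

lemma nilpotent_group_commutative:
  assumes "\<And>x y. x \<in> carrier G \<Longrightarrow> y \<in> carrier G \<Longrightarrow> x \<otimes> y = y \<otimes> x"
  shows "nilpotent_group G"
proof -
  have "commutator G x y = \<one>" if "x \<in> carrier G" "y \<in> carrier G" for x y
    using that assms by (intro commutator_eqI) auto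
  then have "{commutator G x y |x y. x \<in> carrier G \<and> y \<in> carrier G} \<subseteq> {\<one>}"
    by auto
  then have "lower_central G (Suc 0) \<subseteq> {\<one>}"
    by (simp add: generate_subgroup_incl triv_subgroup)
  moreover have "\<one> \<in> lower_central G (Suc 0)"
    by (simp add: generate.one)
  ultimately show ?thesis
    unfolding nilpotent_group_def using is_group by blast
qed

end


section \<open>Normal forms\<close>

text \<open>The defining relations hold, but \<open>A\<close> and \<open>B\<close> are not assumed
  to generate, and normal forms may still coincide.\<close>

locale F_relators = group G for G (structure) +
  fixes A B and p q :: nat and r :: int
  assumes A [simp]: "A \<in> carrier G" and B [simp]: "B \<in> carrier G"
    and prime_p: "prime p" and prime_q: "prime q"
    and r_pow: "[r ^ p = 1] (mod int q)"
    and A_pow: "A [^] p = \<one>" and B_pow: "B [^] q = \<one>"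
    and conj_B: "inv A \<otimes> B \<otimes> A = B [^] r"
begin

text \<open>The first exponent is natural so that \<open>r ^ i\<close> is an integer power; the
  second is an integer because differences and multiples of \<open>r\<close> occur there.\<close>

definition ab_elem :: "nat \<Rightarrow> int \<Rightarrow> 'a" where
  "ab_elem i j = A [^] i \<otimes> B [^] j"

lemma ab_elem_closed [simp]: "ab_elem i j \<in> carrier G"
  by (simp add: ab_elem_def)

text \<open>Conjugation by \<open>A\<close> is an endomorphism taking \<open>B\<close> to
  \<open>B [^] r\<close>, so it multiplies every exponent of \<open>B\<close> by
  \<open>r\<close>.\<close>

lemma B_A: "B [^] (j::int) \<otimes> A = A \<otimes> B [^] (r * j)"
proof -
  interpret c: group_hom G G "\<lambda>x. inv A \<otimes> x \<otimes> A"
    by unfold_locales (auto simp: hom_def m_assoc)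
  have "inv A \<otimes> B [^] j \<otimes> A = B [^] (r * j)"
    using int_pow_pow[of B r j] by (simp add: c.hom_int_pow conj_B mult.commute)
  then show ?thesis
    by (metis A B int_pow_closed inv_closed inv_solve_left m_assoc m_closed)
qed

lemma B_A_pow: "B [^] (j::int) \<otimes> A [^] (k::nat) = A [^] k \<otimes> B [^] (j * r ^ k)"
proof (induction k)
  case (Suc k)
  have "B [^] j \<otimes> A [^] Suc k = (B [^] j \<otimes> A [^] k) \<otimes> A"
    by (simp add: m_assoc)
  also have "\<dots> = A [^] k \<otimes> (B [^] (j * r ^ k) \<otimes> A)"
    by (simp add: Suc m_assoc)
  also have "\<dots> = A [^] Suc k \<otimes> B [^] (j * r ^ Suc k)"
    unfolding B_A by (simp add: m_assoc mult.left_commute)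
  finally show ?case .
qed simp

lemma ab_elem_mult: "ab_elem i j \<otimes> ab_elem k l = ab_elem (i + k) (j * r ^ k + l)"
proof -
  have "ab_elem i j \<otimes> ab_elem k l = A [^] i \<otimes> (B [^] j \<otimes> A [^] k) \<otimes> B [^] l"
    by (simp add: ab_elem_def m_assoc)
  also have "\<dots> = (A [^] i \<otimes> A [^] k) \<otimes> (B [^] (j * r ^ k) \<otimes> B [^] l)"
    unfolding B_A_pow by (simp add: m_assoc)
  finally show ?thesis
    by (simp add: ab_elem_def nat_pow_mult int_pow_mult)
qed

lemma one_eq_ab_elem: "\<one> = ab_elem 0 0"
  by (simp add: ab_elem_def)

lemma ab_elem_cong:
  assumes "[i = i'] (mod p)" "[j = j'] (mod int q)"
  shows "ab_elem i j = ab_elem i' j'"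
proof -
  have "A [^] i = A [^] (i mod p)" for i
  proof -
    have "A [^] i = A [^] (p * (i div p) + i mod p)" by simp
    also have "\<dots> = (A [^] p) [^] (i div p) \<otimes> A [^] (i mod p)"
      by (simp only: nat_pow_mult[symmetric] nat_pow_pow A)
    finally show ?thesis by (simp add: A_pow)
  qed
  moreover have "B [^] j = B [^] (j mod int q)" for j
  proof -
    have "B [^] j = B [^] (int q * (j div int q) + j mod int q)" by simp
    also have "\<dots> = (B [^] int q) [^] (j div int q) \<otimes> B [^] (j mod int q)"
      by (simp only: int_pow_mult int_pow_pow B)
    finally show ?thesis by (simp add: int_pow_int B_pow)
  qed
  ultimately show ?thesis
    using assms unfolding ab_elem_def cong_def by metis
qed

text \<open>The two products have \<open>B\<close>-exponents \<open>j * r ^ k + l\<close> and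
  \<open>l * r ^ i + j\<close>; the commutator is the power of \<open>B\<close> that makes up the
  difference.\<close>

lemma commutator_ab_elem:
  "commutator G (ab_elem i j) (ab_elem k l) = ab_elem 0 (j * (r ^ k - 1) - l * (r ^ i - 1))"
  by (rule commutator_eqI) (simp_all add: ab_elem_mult algebra_simps)

text \<open>After the first commutator only a power of \<open>B\<close> is left, and each further
  commutator multiplies its exponent by \<open>r ^ k - 1\<close>.\<close>

lemma engel_ab_elem:
  "engel G (ab_elem i j) (Suc n) (ab_elem k l) =
    ab_elem 0 ((j * (r ^ k - 1) - l * (r ^ i - 1)) * (r ^ k - 1) ^ n)"
  by (induction n) (simp_all add: commutator_ab_elem algebra_simps)

lemma inv_ab_elem_0: "inv (ab_elem 0 j) = ab_elem 0 (- j)"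
  by (rule inv_equality) (simp_all add: ab_elem_mult one_eq_ab_elem)

text \<open>Normal forms are stable under right multiplication by letters, so every word can be
  reduced letter by letter. The inverse of \<open>A\<close> enters as \<open>A [^] (p - 1)\<close>
  to keep the exponent natural.\<close>

lemma ab_elem_mult_letters:
  shows "ab_elem i j \<otimes> A = ab_elem (Suc i) (j * r)"
    and "ab_elem i j \<otimes> inv A = ab_elem (i + (p - 1)) (j * r ^ (p - 1))"
    and "ab_elem i j \<otimes> B = ab_elem i (j + 1)"
    and "ab_elem i j \<otimes> inv B = ab_elem i (j - 1)"
proof -
  have A': "ab_elem (Suc 0) 0 = A" and B': "ab_elem 0 1 = B"
    by (simp_all add: ab_elem_def)
  show A_right: "ab_elem i j \<otimes> A = ab_elem (Suc i) (j * r)" for i j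
    using ab_elem_mult[of i j "Suc 0" 0] by (simp add: A')
  show "ab_elem i j \<otimes> B = ab_elem i (j + 1)"
    using ab_elem_mult[of i j 0 1] by (simp add: B')
  have "inv B = ab_elem 0 (- 1)"
    using inv_ab_elem_0[of 1] by (simp add: B')
  then show "ab_elem i j \<otimes> inv B = ab_elem i (j - 1)"
    by (simp add: ab_elem_mult)
  have "ab_elem (p - 1) 0 \<otimes> A = \<one>"
    using ab_elem_cong[of p 0 0 0] prime_gt_0_nat[OF prime_p]
    unfolding A_right one_eq_ab_elem by (simp add: cong_def)
  then have "inv A = ab_elem (p - 1) 0"
    by (simp add: inv_equality)
  then show "ab_elem i j \<otimes> inv A = ab_elem (i + (p - 1)) (j * r ^ (p - 1))"
    by (simp add: ab_elem_mult)
qed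

end


section \<open>The Engel graph from the normal form\<close>

text \<open>Adds existence and uniqueness of normal forms; the graph is computed from this
  interface, without returning to words.\<close>

locale F_normal_form = F_relators +
  assumes r_neq_1: "[r \<noteq> 1] (mod int q)"
    and carrier_ab_elem: "carrier G = range (\<lambda>(i, j). ab_elem i j)"
    and ab_elem_eqD: "ab_elem i j = ab_elem i' j' \<Longrightarrow> [i = i'] (mod p) \<and> [j = j'] (mod int q)"
begin

lemma ab_elem_eq_iff: "ab_elem i j = ab_elem i' j' \<longleftrightarrow> [i = i'] (mod p) \<and> [j = j'] (mod int q)"
  using ab_elem_cong ab_elem_eqD by blast

lemma ab_elem_0_eq_one_iff: "ab_elem 0 j = \<one> \<longleftrightarrow> int q dvd j"
  by (simp add: one_eq_ab_elem ab_elem_eq_iff cong_0_iff)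

lemma prime_int_q: "prime (int q)"
  using prime_q by simp

text \<open>As \<open>p\<close> is prime, \<open>k\<close> has an inverse \<open>u\<close> mod
  \<open>p\<close>. If \<open>r ^ k\<close> were 1 mod \<open>q\<close>, then so would be
  \<open>r ^ (k * u)\<close>, which is congruent to \<open>r\<close>.\<close>

lemma not_dvd_r_pow:
  assumes "\<not> p dvd k"
  shows "\<not> int q dvd r ^ k - 1"
proof
  assume "int q dvd r ^ k - 1"
  then have rk: "[r ^ k = 1] (mod int q)"
    by (simp add: cong_iff_dvd_diff)
  have "coprime k p"
    using assms prime_p by (metis coprime_commute prime_imp_coprime)
  then obtain u where u: "[k * u = 1] (mod p)"
    using cong_solve_coprime_nat[of k p] by auto
  \<comment> \<open>Guards the truncated subtraction in \<open>k * u - 1\<close>.\<close>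
  have "k * u \<noteq> 0"
    using u prime_gt_1_nat[OF prime_p] by (metis cong_0_1_nat nat_neq_iff)
  then have "p dvd k * u - 1"
    using u cong_altdef_nat[of 1 "k * u" p] by (simp add: cong_sym_eq Suc_le_eq)
  then obtain t where t: "k * u = p * t + 1"
    using \<open>k * u \<noteq> 0\<close> by (metis Suc_diff_1 Suc_eq_plus1 dvdE not_gr_zero)
  have "[(r ^ k) ^ u = 1] (mod int q)"
    using cong_pow[OF rk, of u] by simp
  moreover have "[(r ^ p) ^ t * r = 1 * r] (mod int q)"
    using cong_pow[OF r_pow, of t] by (intro cong_scalar_right) simp
  moreover have "(r ^ k) ^ u = (r ^ p) ^ t * r"
    by (simp add: t flip: power_mult)
  ultimately have "[r = 1] (mod int q)"
    by (metis cong_sym cong_trans mult_1)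
  with r_neq_1 show False ..
qed

text \<open>The powers of \<open>B\<close>; for \<open>p = 2\<close> these are the rotations of a
  dihedral group.\<close>

definition rotations :: "'a set" where
  "rotations = range (ab_elem 0)"

lemma ab_elem_in_rotations_iff: "ab_elem i j \<in> rotations \<longleftrightarrow> p dvd i"
  by (auto simp: rotations_def image_iff ab_elem_eq_iff cong_0_iff intro: cong_refl)

text \<open>A conjugate of \<open>h\<close> is \<open>h\<close> times a commutator, and all
  commutators are powers of \<open>B\<close>.\<close>

lemma normal_rotations: "rotations \<lhd> G"
  unfolding normal_inv_iff
proof (intro conjI ballI)
  show sub: "subgroup rotations G"
    by (unfold_locales) (auto simp: rotations_def ab_elem_mult inv_ab_elem_0 one_eq_ab_elem)
  fix x h assume "x \<in> carrier G" and h: "h \<in> rotations"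
  then have "inv x \<in> carrier G" "h \<in> carrier G"
    by (auto simp: rotations_def)
  then have "commutator G h (inv x) \<in> rotations"
    unfolding carrier_ab_elem by (auto simp: commutator_ab_elem ab_elem_in_rotations_iff)
  then show "x \<otimes> h \<otimes> inv x \<in> rotations"
    using \<open>x \<in> carrier G\<close> \<open>h \<in> carrier G\<close> h sub
    by (simp add: conj_eq_mult_commutator subgroup.m_closed)
qed

lemma nilpotent_rotations: "nilpotent_group (G\<lparr>carrier := rotations\<rparr>)"
proof (rule group.nilpotent_group_commutative)
  show "group (G\<lparr>carrier := rotations\<rparr>)"
    using normal_rotations normal_imp_subgroup subgroup.subgroup_is_group by blast
qed (auto simp: rotations_def ab_elem_mult add.commute)

text \<open>An element outside the rotations is not left Engel, because \<open>r\<^sup>i - 1\<close> is a unit mod \<open>q\<close>.\<close>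

lemma nilpotent_normal_subset_rotations:
  assumes "N \<lhd> G" "nilpotent_group (G\<lparr>carrier := N\<rparr>)"
  shows "N \<subseteq> rotations"
proof
  fix x assume x: "x \<in> N"
  then have "x \<in> carrier G"
    using subgroup.mem_carrier[OF normal_imp_subgroup[OF assms(1)]] by blast
  then obtain i j where ij: "x = ab_elem i j"
    by (auto simp: carrier_ab_elem)
  \<comment> \<open>Testing against \<open>B\<close> itself leaves exactly
    \<open>(r ^ i - 1) ^ Suc n\<close> as exponent, independent of \<open>j\<close>.\<close>
  obtain n where "engel G (ab_elem 0 1) (Suc n) x = \<one>"
    using nilpotent_normal_engel[OF assms x ab_elem_closed] by (metis Suc_pred)
  then have "int q dvd (r ^ i - 1) ^ Suc n"
    unfolding ij engel_ab_elem ab_elem_0_eq_one_iff by simp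
  then have "int q dvd r ^ i - 1"
    using prime_dvd_power prime_int_q by blast
  then show "x \<in> rotations"
    using not_dvd_r_pow by (auto simp: ij ab_elem_in_rotations_iff)
qed

text \<open>The rotations are the largest member of the family, so the union is already a
  subgroup.\<close>

lemma fitting_eq_rotations: "fitting G = rotations"
proof -
  have "\<Union>{N. N \<lhd> G \<and> nilpotent_group (G\<lparr>carrier := N\<rparr>)} = rotations"
    using nilpotent_normal_subset_rotations nilpotent_rotations normal_rotations by blast
  then show ?thesis
    unfolding fitting_def
    using normal_rotations normal_imp_subgroup generateI[of rotations]
    by (metis generate_subgroup_incl generate.incl subset_antisym subsetI)
qed

text \<open>The powers of \<open>r ^ k - 1\<close> are units mod \<open>q\<close>, so the length of
  the Engel word does not affect whether it vanishes.\<close>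

lemma engel_non_rotation:
  assumes "\<not> p dvd k"
  shows "(\<forall>n>0. engel G (ab_elem i j) n (ab_elem k l) \<noteq> \<one>) \<longleftrightarrow>
    \<not> int q dvd j * (r ^ k - 1) - l * (r ^ i - 1)"
proof -
  let ?d = "j * (r ^ k - 1) - l * (r ^ i - 1)"
  have "engel G (ab_elem i j) (Suc n) (ab_elem k l) = \<one> \<longleftrightarrow> int q dvd ?d" for n
    unfolding engel_ab_elem ab_elem_0_eq_one_iff prime_dvd_mult_iff[OF prime_int_q]
    using not_dvd_r_pow[OF assms] prime_dvd_power[OF prime_int_q] by blast
  then show ?thesis
    by (metis Suc_pred zero_less_Suc)
qed

text \<open>The part of slope \<open>c\<close> is the conjugate \<open>b\<^sup>c \<langle>a\<rangle> b\<^sup>-\<^sup>c\<close> without the identity.\<close>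

definition vertex :: "nat \<times> nat \<Rightarrow> 'a" where
  "vertex = (\<lambda>(c, m). ab_elem (Suc m) (int c * (r ^ Suc m - 1)))"

lemma not_dvd_Suc: "m < p - 1 \<Longrightarrow> \<not> p dvd Suc m"
  by (auto dest: dvd_imp_le)

text \<open>\<open>Suc m\<close> runs through the nonzero residues mod \<open>p\<close>; given it,
  the slope is recovered by dividing by the unit \<open>r ^ Suc m - 1\<close>.\<close>

lemma bij_betw_vertex: "bij_betw vertex ({..<q} \<times> {..<p - 1}) (carrier G - fitting G)"
  unfolding bij_betw_def
proof
  have cancel: "c = c'"
    if "[int c * (r ^ Suc m - 1) = int c' * (r ^ Suc m - 1)] (mod int q)"
      "c < q" "c' < q" "m < p - 1" for c c' m
  proof -
    have "coprime (r ^ Suc m - 1) (int q)"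
      using not_dvd_r_pow[OF not_dvd_Suc[OF that(4)]] prime_int_q prime_imp_coprime
        coprime_commute by blast
    then have "[int c = int c'] (mod int q)"
      using that(1) cong_mult_rcancel by blast
    then show ?thesis
      using that(2,3) by (simp add: cong_int_iff cong_less_modulus_unique_nat)
  qed
  show "inj_on vertex ({..<q} \<times> {..<p - 1})"
  proof (rule inj_onI)
    fix u v assume uv: "u \<in> {..<q} \<times> {..<p - 1}" "v \<in> {..<q} \<times> {..<p - 1}" "vertex u = vertex v"
    obtain c m c' m' where cm: "u = (c, m)" "v = (c', m')"
      by (cases u, cases v)
    have *: "c < q" "m < p - 1" "c' < q" "m' < p - 1"
      using uv by (simp_all add: cm)
    have "vertex (c, m) = vertex (c', m')"
      using uv cm by simp
    then have "[Suc m = Suc m'] (mod p)"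
      and c: "[int c * (r ^ Suc m - 1) = int c' * (r ^ Suc m' - 1)] (mod int q)"
      by (simp_all only: vertex_def prod.case ab_elem_eq_iff)
    then have "Suc m = Suc m'"
      using * cong_less_modulus_unique_nat[of "Suc m" "Suc m'" p] by simp
    then show "u = v"
      using c cancel * by (auto simp: cm)
  qed
  show "vertex ` ({..<q} \<times> {..<p - 1}) = carrier G - fitting G" (is "?V = ?W")
  proof
    show "?V \<subseteq> ?W"
      using not_dvd_Suc
      by (auto simp: vertex_def fitting_eq_rotations ab_elem_in_rotations_iff simp del: power_Suc)
    show "?W \<subseteq> ?V"
    proof
      fix x assume "x \<in> ?W"
      then obtain i j where x: "x = ab_elem i j" "\<not> p dvd i"
        by (auto simp: carrier_ab_elem fitting_eq_rotations ab_elem_in_rotations_iff)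
      define m where "m = i mod p - 1"
      have "0 < i mod p" "i mod p < p"
        using x(2) prime_gt_0_nat[OF prime_p] by (simp_all add: mod_greater_zero_iff_not_dvd)
      then have m: "Suc m = i mod p" "m < p - 1"
        by (simp_all add: m_def)
      have "coprime (r ^ Suc m - 1) (int q)"
        using not_dvd_r_pow[OF not_dvd_Suc[OF m(2)]] prime_int_q prime_imp_coprime
          coprime_commute by blast
      then obtain u where u: "[(r ^ Suc m - 1) * u = 1] (mod int q)"
        using cong_solve_coprime_int by blast
      \<comment> \<open>With \<open>u\<close> inverse to \<open>r ^ Suc m - 1\<close>, this is the
        slope of \<open>x\<close>, reduced mod \<open>q\<close>.\<close>
      define c where "c = nat (j * u mod int q)"
      have q: "int q > 0"
        using prime_gt_0_nat[OF prime_q] by simp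
      then have c: "int c = j * u mod int q" "c < q"
        using pos_mod_bound[OF q, of "j * u"] pos_mod_sign[OF q, of "j * u"]
        by (simp_all add: c_def)
      have "[int c * (r ^ Suc m - 1) = (j * u) * (r ^ Suc m - 1)] (mod int q)"
        unfolding c(1) by (intro cong_scalar_right) simp
      also have "(j * u) * (r ^ Suc m - 1) = j * ((r ^ Suc m - 1) * u)"
        by (simp only: ac_simps)
      also have "[\<dots> = j * 1] (mod int q)"
        using u by (rule cong_scalar_left)
      finally have "x = vertex (c, m)"
        by (simp add: x vertex_def ab_elem_eq_iff m(1) cong_sym_eq del: power_Suc)
      then show "x \<in> ?V"
        using c(2) m(2) by blast
    qed
  qed
qed

text \<open>On vertices the exponent factors as the difference of the slopes times two units mod
  \<open>q\<close>.\<close>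

lemma engel_vertex:
  assumes "u \<in> {..<q} \<times> {..<p - 1}" "v \<in> {..<q} \<times> {..<p - 1}"
  shows "(\<forall>n>0. engel G (vertex u) n (vertex v) \<noteq> \<one>) \<longleftrightarrow> fst u \<noteq> fst v"
proof -
  obtain c m d n where uv: "u = (c, m)" "v = (d, n)"
    by (cases u, cases v)
  let ?x = "r ^ Suc m - 1" and ?y = "r ^ Suc n - 1"
  have "m < p - 1" "n < p - 1" "c < q" "d < q"
    using assms by (simp_all add: uv)
  then have n: "\<not> p dvd Suc n" and nd: "\<not> int q dvd ?x" "\<not> int q dvd ?y"
    using not_dvd_Suc not_dvd_r_pow by blast+
  have "(\<forall>n>0. engel G (vertex u) n (vertex v) \<noteq> \<one>) \<longleftrightarrow>
      \<not> int q dvd int c * ?x * ?y - int d * ?y * ?x"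
    unfolding uv vertex_def prod.case by (rule engel_non_rotation[OF n])
  also have "int c * ?x * ?y - int d * ?y * ?x = (int c - int d) * (?x * ?y)"
    by (simp only: algebra_simps)
  also have "int q dvd (int c - int d) * (?x * ?y) \<longleftrightarrow> [int c = int d] (mod int q)"
    using nd by (simp only: prime_dvd_mult_iff[OF prime_int_q] cong_iff_dvd_diff) blast
  also have "\<dots> \<longleftrightarrow> c = d"
    using \<open>c < q\<close> \<open>d < q\<close> by (auto simp: cong_int_iff cong_less_modulus_unique_nat)
  finally show ?thesis by (simp add: uv)
qed

end


section \<open>The presentation\<close>

locale F_params =
  fixes p q :: nat and r :: int
  assumes p_pos: "p > 0" and q_pos: "q > 0" and r_pow_p: "[r ^ p = 1] (mod int q)"
begin

text \<open>
  The right regular action of words on normal forms, \<open>(i, j)\<close> standing for \<open>a\<^sup>i b\<^sup>j\<close>;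
  it separates normal forms because relations act trivially.
\<close>

fun act_letter :: "gen \<times> bool \<Rightarrow> int \<times> int \<Rightarrow> int \<times> int" where
  "act_letter (Gen_a, True) (i, j) = ((i + 1) mod int p, (j * r) mod int q)"
| "act_letter (Gen_a, False) (i, j) = ((i - 1) mod int p, (j * r ^ (p - 1)) mod int q)"
| "act_letter (Gen_b, True) (i, j) = (i, (j + 1) mod int q)"
| "act_letter (Gen_b, False) (i, j) = (i, (j - 1) mod int q)"

text \<open>\<open>fold\<close> applies the leftmost letter first, which makes this a right
  action.\<close>

abbreviation "act \<equiv> fold act_letter"

text \<open>Reduced residues, so that relators fix states exactly and not just up to
  congruence.\<close>

definition states :: "(int \<times> int) set" where
  "states = {0..<int p} \<times> {0..<int q}"

lemma act_letter_states: "s \<in> states \<Longrightarrow> act_letter l s \<in> states"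
  using p_pos q_pos by (cases "(l, s)" rule: act_letter.cases) (auto simp: states_def)

lemma act_states: "s \<in> states \<Longrightarrow> act u s \<in> states"
  by (induction u arbitrary: s) (simp_all add: act_letter_states)

lemma r_mult_pow: "[r * r ^ (p - 1) = 1] (mod int q)"
  using r_pow_p p_pos by (simp add: power_eq_if)

text \<open>The two letters over \<open>Gen_a\<close> scale the second coordinate by
  \<open>r\<close> and \<open>r ^ (p - 1)\<close>, which are inverse mod \<open>q\<close>.\<close>

lemma act_cancel: "s \<in> states \<Longrightarrow> act [(g, e), (g, \<not> e)] s = s"
proof -
  assume s: "s \<in> states"
  obtain i j where ij: "s = (i, j)" by (cases s)
  have j: "j mod int q = j" and i: "i mod int p = i"
    using s by (auto simp: ij states_def)
  have "[j * (r * r ^ (p - 1)) = j * 1] (mod int q)"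
    by (intro cong_scalar_left r_mult_pow)
  then have "j * (r * r ^ (p - 1)) mod int q = j"
    by (simp add: cong_def j)
  then show ?thesis
    by (cases g; cases e) (simp_all add: ij i j mod_simps ac_simps)
qed

lemma act_a_pow:
  "(i, j) \<in> states \<Longrightarrow>
    act (replicate n (Gen_a, True)) (i, j) = ((i + int n) mod int p, (j * r ^ n) mod int q)"
  by (induction n arbitrary: i j)
    (use act_letter_states[of _ "(Gen_a, True)"] in \<open>force simp: states_def mod_simps ac_simps\<close>)+

lemma act_b_pow:
  "(i, j) \<in> states \<Longrightarrow> act (gen_pow Gen_b k) (i, j) = (i, (j + k) mod int q)"
proof -
  assume s: "(i, j) \<in> states"
  have "act (replicate n (Gen_b, True)) (i, j) = (i, (j + int n) mod int q)"
    if "(i, j) \<in> states" for n j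
    using that q_pos
    by (induction n arbitrary: j) (auto simp: states_def mod_simps ac_simps simp del: fold_replicate)
  moreover have "act (replicate n (Gen_b, False)) (i, j) = (i, (j - int n) mod int q)"
    if "(i, j) \<in> states" for n j
    using that q_pos
    by (induction n arbitrary: j) (auto simp: states_def mod_simps algebra_simps simp del: fold_replicate)
  ultimately show ?thesis
    using s by (cases "0 \<le> k") (simp_all add: gen_pow_def del: fold_replicate)
qed

lemma act_relation:
  assumes "(u, v) \<in> F_relations p q r" "s \<in> states"
  shows "act u s = act v s"
proof -
  obtain i j where ij: "s = (i, j)" by (cases s)
  have s: "(i, j) \<in> states" and j: "j mod int q = j" and i: "i mod int p = i"
    using assms(2) by (auto simp: ij states_def)
  have pow: "j * r ^ p mod int q = j"
    using cong_scalar_left[OF r_pow_p, of j] by (simp add: cong_def j)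
  \<comment> \<open>The left side is the second coordinate after the inverse of
    \<open>Gen_a\<close>, then \<open>Gen_b\<close>, then \<open>Gen_a\<close>.\<close>
  have conj: "(j * r ^ (p - 1) + 1) * r mod int q = (j + r) mod int q"
  proof -
    have "[j * (r * r ^ (p - 1)) + r = j * 1 + r] (mod int q)"
      by (intro cong_add cong_scalar_left r_mult_pow cong_refl)
    then show ?thesis
      by (simp add: cong_def algebra_simps)
  qed
  consider "u = gen_pow Gen_a (int p)" "v = []" | "u = gen_pow Gen_b (int q)" "v = []"
    | "u = gen_pow Gen_a (-1) @ gen_pow Gen_b 1 @ gen_pow Gen_a 1" "v = gen_pow Gen_b r"
    using assms(1) by (auto simp: F_relations_def)
  then show ?thesis
  proof cases
    case 1
    then show ?thesis
      using act_a_pow[OF s, of p] by (simp add: ij gen_pow_def i pow)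
  next
    case 2
    then show ?thesis
      using act_b_pow[OF s, of "int q"] by (simp add: ij j)
  next
    case 3
    then show ?thesis
      unfolding ij 3(2) act_b_pow[OF s]
      using conj by (simp add: gen_pow_def mod_simps i)
  qed
qed

text \<open>Makes the action an invariant of word classes, so that distinct effects certify distinct
  group elements.\<close>

lemma act_pres_eq:
  assumes "pres_eq (F_relations p q r) u v" "s \<in> states"
  shows "act u s = act v s"
  using assms
proof (induction arbitrary: s rule: pres_eq.induct)
  case (cancel g e)
  then show ?case using act_cancel by fastforce
next
  case (append u u' v v')
  then show ?case by (simp add: act_states)
qed (simp_all add: act_relation)

end

section \<open>Powers and inverses of generators in a presented group\<close>

lemma word_class_replicate:
  "word_class R (replicate n l) = word_class R [l] [^]\<^bsub>presented_group R\<^esub> n"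
proof (induction n)
  case (Suc n)
  have "replicate (Suc n) l = replicate n l @ [l]"
    by (simp add: replicate_append_same)
  then show ?case
    by (simp add: mult_word_class del: replicate_Suc flip: Suc.IH)
qed (simp add: one_presented_group)

lemma inv_word_class_letter:
  "inv\<^bsub>presented_group R\<^esub> word_class R [(g, True)] = word_class R [(g, False)]"
proof -
  interpret group "presented_group R" by (rule group_presented_group)
  have "pres_eq R [(g, False), (g, True)] []"
    using pres_eq.cancel[of R g False] by simp
  then show ?thesis
    by (intro inv_equality)
      (simp_all add: carrier_presented_group rangeI mult_word_class one_presented_group word_class_eq_iff)
qed

lemma word_class_gen_pow:
  "word_class R (gen_pow g k) = word_class R [(g, True)] [^]\<^bsub>presented_group R\<^esub> k"
proof -
  interpret group "presented_group R" by (rule group_presented_group)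
  let ?x = "word_class R [(g, True)]"
  have x: "?x \<in> carrier (presented_group R)"
    by (simp add: carrier_presented_group)
  show ?thesis
  proof (cases k rule: int_cases2)
    case (nonneg n)
    have "gen_pow g (int n) = replicate n (g, True)"
      by (simp add: gen_pow_def)
    then show ?thesis
      unfolding nonneg int_pow_int by (simp only: word_class_replicate)
  next
    case (nonpos n)
    \<comment> \<open>At \<open>n = 0\<close> the sign flag in \<open>gen_pow\<close> is
      \<open>True\<close>, but the word is empty.\<close>
    have "word_class R (gen_pow g (- int n)) = word_class R (replicate n (g, False))"
      by (cases "n = 0") (simp_all add: gen_pow_def)
    then show ?thesis
      unfolding nonpos int_pow_neg_int[OF x] nat_pow_inv[OF x, symmetric] inv_word_class_letter
      by (simp only: word_class_replicate)
  qed
qed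

section \<open>Existence and uniqueness of normal forms in the presented group\<close>

context
  fixes p q :: nat and r :: int
  assumes prime_p: "prime p" and prime_q: "prime q"
    and r_pow_p: "[r ^ p = 1] (mod int q)" and r_neq_1: "[r \<noteq> 1] (mod int q)"
begin

abbreviation "cls \<equiv> word_class (F_relations p q r)"

lemma F_relators: "F_relators (F_group p q r) (cls [(Gen_a, True)]) (cls [(Gen_b, True)]) p q r"
proof -
  interpret group "F_group p q r"
    unfolding F_group_def by (rule group_presented_group)
  have rel: "cls u = cls v" if "(u, v) \<in> F_relations p q r" for u v
    using that pres_eq.relation word_class_eq_iff by blast
  have conj: "inv\<^bsub>F_group p q r\<^esub> cls [(Gen_a, True)] \<otimes>\<^bsub>F_group p q r\<^esub> cls [(Gen_b, True)]
        \<otimes>\<^bsub>F_group p q r\<^esub> cls [(Gen_a, True)] =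
      cls (gen_pow Gen_a (-1) @ gen_pow Gen_b 1 @ gen_pow Gen_a 1)"
    unfolding F_group_def inv_word_class_letter mult_word_class by (simp add: gen_pow_def)
  show ?thesis
  proof unfold_locales
    have "cls (gen_pow Gen_a (int p)) = cls []"
      by (rule rel) (simp add: F_relations_def)
    then show "cls [(Gen_a, True)] [^]\<^bsub>F_group p q r\<^esub> p = \<one>\<^bsub>F_group p q r\<^esub>"
      unfolding F_group_def word_class_gen_pow int_pow_int one_presented_group .
    have "cls (gen_pow Gen_b (int q)) = cls []"
      by (rule rel) (simp add: F_relations_def)
    then show "cls [(Gen_b, True)] [^]\<^bsub>F_group p q r\<^esub> q = \<one>\<^bsub>F_group p q r\<^esub>"
      unfolding F_group_def word_class_gen_pow int_pow_int one_presented_group .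
    have "cls (gen_pow Gen_a (-1) @ gen_pow Gen_b 1 @ gen_pow Gen_a 1) = cls (gen_pow Gen_b r)"
      by (rule rel) (simp add: F_relations_def)
    then show "inv\<^bsub>F_group p q r\<^esub> cls [(Gen_a, True)] \<otimes>\<^bsub>F_group p q r\<^esub> cls [(Gen_b, True)]
        \<otimes>\<^bsub>F_group p q r\<^esub> cls [(Gen_a, True)] = cls [(Gen_b, True)] [^]\<^bsub>F_group p q r\<^esub> r"
      unfolding conj unfolding F_group_def word_class_gen_pow .
    show "cls [(Gen_a, True)] \<in> carrier (F_group p q r)"
      "cls [(Gen_b, True)] \<in> carrier (F_group p q r)"
      by (simp_all add: F_group_def carrier_presented_group rangeI)
  qed (rule prime_p prime_q r_pow_p)+
qed

lemma F_normal_form: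
  "F_normal_form (F_group p q r) (cls [(Gen_a, True)]) (cls [(Gen_b, True)]) p q r"
proof -
  interpret F: F_relators "F_group p q r" "cls [(Gen_a, True)]" "cls [(Gen_b, True)]" p q r
    by (rule F_relators)
  interpret F_params p q r
    by unfold_locales (simp_all add: prime_gt_0_nat prime_p prime_q r_pow_p)
  \<comment> \<open>Induction from the end of the word, because letters are absorbed by right
    multiplication.\<close>
  have word: "\<exists>i j. cls u = F.ab_elem i j" for u
  proof (induction u rule: rev_induct)
    case Nil
    then show ?case
      using F.one_eq_ab_elem by (metis F_group_def one_presented_group)
  next
    case (snoc l u)
    then obtain i j where "cls u = F.ab_elem i j" by blast
    moreover have "cls (u @ [l]) = cls u \<otimes>\<^bsub>F_group p q r\<^esub> cls [l]"
      by (simp add: F_group_def mult_word_class)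
    moreover have "cls [(g, False)] = inv\<^bsub>F_group p q r\<^esub> cls [(g, True)]" for g
      by (simp add: F_group_def inv_word_class_letter)
    moreover obtain g e where "l = (g, e)" by (cases l)
    ultimately show ?case
      by (cases g; cases e) (auto simp: F.ab_elem_mult_letters)
  qed
  have normal: "F.ab_elem i j = cls (replicate i (Gen_a, True) @ gen_pow Gen_b j)" for i j
    unfolding F.ab_elem_def
    by (simp add: F_group_def word_class_replicate word_class_gen_pow flip: mult_word_class)
  show ?thesis
  proof unfold_locales
    show "carrier (F_group p q r) = range (\<lambda>(i, j). F.ab_elem i j)"
    proof
      show "carrier (F_group p q r) \<subseteq> range (\<lambda>(i, j). F.ab_elem i j)"
        using word by (fastforce simp: F_group_def carrier_presented_group)
    qed auto
  next
    fix i i' j j'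
    assume "F.ab_elem i j = F.ab_elem i' j'"
    then have eq: "pres_eq (F_relations p q r) (replicate i (Gen_a, True) @ gen_pow Gen_b j)
        (replicate i' (Gen_a, True) @ gen_pow Gen_b j')"
      by (simp add: normal word_class_eq_iff)
    have s: "(0, 0) \<in> states" and s': "(int i mod int p, 0) \<in> states" for i
      using p_pos q_pos by (simp_all add: states_def)
    \<comment> \<open>Acting on the base state \<open>(0, 0)\<close> reads off both exponents of a
      normal form.\<close>
    have "(int i mod int p, j mod int q) = (int i' mod int p, j' mod int q)"
      using act_pres_eq[OF eq s] by (simp add: act_a_pow[OF s] act_b_pow[OF s'] del: fold_replicate)
    then show "[i = i'] (mod p) \<and> [j = j'] (mod int q)"
      by (simp add: cong_def flip: zmod_int)
  qed (rule r_neq_1)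
qed

end


section \<open>The isomorphism of graphs\<close>

text \<open>Arcs are pairs of vertices, so the bijection of vertices determines the map on
  arcs.\<close>

lemma digraph_iso_with_projI:
  assumes "pair_wf_digraph G" "bij_betw f (pverts G) (pverts H)"
    and parcs: "parcs H = map_prod f f ` parcs G"
  shows "digraph_iso (with_proj G) (with_proj H)"
proof -
  interpret pair_wf_digraph G by fact
  let ?h = "\<lparr>iso_verts = f, iso_arcs = map_prod f f, iso_head = snd, iso_tail = fst\<rparr>"
  have "parcs G \<subseteq> pverts G \<times> pverts G"
    using wellformed' by auto
  moreover have "inj_on (map_prod f f) (pverts G \<times> pverts G)"
    using assms(2) by (intro map_prod_inj_on) (auto simp: bij_betw_def)
  ultimately have "pre_digraph.digraph_isomorphism (with_proj G) ?h"
    using assms(1,2) inj_on_subset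
    by (auto simp: pre_digraph.digraph_isomorphism_def wf_digraph_wp_iff bij_betw_def)
  moreover have "with_proj H = app_iso ?h (with_proj G)"
    using assms(2) by (simp add: app_iso_def with_proj_def parcs bij_betw_def)
  ultimately show ?thesis
    unfolding digraph_iso_def by blast
qed

theorem theorem6p2:
  fixes p q :: nat and r :: int
  assumes "prime p" and "prime q"
    and "[q = 1] (mod p)"
    and "[r ^ p = 1] (mod int q)"
    and "[r \<noteq> 1] (mod int q)"
  shows "digraph_iso (with_proj (Ec_minus (F_group p q r)))
    (with_proj (complete_multipartite q (p - 1)))"
proof -
  interpret F_normal_form "F_group p q r" "word_class (F_relations p q r) [(Gen_a, True)]"
    "word_class (F_relations p q r) [(Gen_b, True)]" p q r
    using assms by (intro F_normal_form)
  let ?K = "complete_multipartite q (p - 1)" and ?E = "Ec_minus (F_group p q r)"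
  let ?V = "{..<q} \<times> {..<p - 1}"
  have image: "vertex ` ?V = carrier (F_group p q r) - fitting (F_group p q r)"
    and inj: "inj_on vertex ?V"
    using bij_betw_vertex by (auto simp: bij_betw_def)
  \<comment> \<open>Adjacency asks for both Engel conditions; each amounts to distinct slopes, which
    also forces distinct vertices.\<close>
  have arc: "(vertex u, vertex v) \<in> parcs ?E \<longleftrightarrow> (u, v) \<in> parcs ?K"
    if "u \<in> ?V" "v \<in> ?V" for u v
  proof -
    have "vertex u \<in> vertex ` ?V" "vertex v \<in> vertex ` ?V"
      using that by blast+
    moreover have "vertex u = vertex v \<longleftrightarrow> u = v"
      using inj that by (rule inj_on_eq_iff)
    ultimately show ?thesis
      using engel_vertex[OF that] engel_vertex[OF that(2,1)] that
      unfolding image by (auto simp: Ec_minus_def complete_multipartite_def)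
  qed
  have "parcs ?E \<subseteq> vertex ` ?V \<times> vertex ` ?V" "parcs ?K \<subseteq> ?V \<times> ?V"
    unfolding image by (auto simp: Ec_minus_def complete_multipartite_def)
  then have "parcs ?E = map_prod vertex vertex ` parcs ?K"
    using arc by (force dest: subsetD)
  moreover have wf: "pair_wf_digraph ?K"
    using pair_graph_complete_multipartite
    by (simp add: pair_graph_def pair_digraph_def pair_fin_digraph_def)
  \<comment> \<open>\<open>vertex\<close> maps out of the multipartite graph, so the isomorphism is
    built in this direction and then reversed.\<close>
  ultimately have "digraph_iso (with_proj ?K) (with_proj ?E)"
    using bij_betw_vertex
    by (intro digraph_iso_with_projI) (simp_all add: Ec_minus_def complete_multipartite_def)
  then show ?thesis
    using wf digraph_iso_swap wf_digraph_wp_iff by blast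
qed

end
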